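(* Let $S=\sum_{i=1}^n X_i$, where $X_i\sim\mathrm{Bernoulli}(p_i)$, $p_i\in[0,1]$, are independent. Let $k\le\mathbb{E}[S]$ be a positive integer, let $\lambda=\mathbb{E}[S]$ and $\gamma=\mathbb{E}[S]/k\ge1$. Then \[\Pr[S\le k-1]\le e^{-\lambda}\sum_{i=0}^{k-1}\frac{\lambda^i}{i!}\le e^{-\gamma}(e/2).\] *)

theory Defs
  imports "HOL-Probability.Probability"
begin

definition (in prob_space) bernoulli_distributed :: "('a \<Rightarrow> real) \<Rightarrow> real \<Rightarrow> bool" where
  "bernoulli_distributed X p \<longleftrightarrow>
     random_variable borel X \<and>
     distr M borel X = distr (measure_pmf (bernoulli_pmf p)) borel of_bool"

end

theory Submission
  imports Defs
begin

text \<open>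
  Each Bernoulli summand is replaced, one at a time, by a Poisson variable of the same mean. Along
  the interpolation Bernoulli(\<open>(1 - t) p\<close>) + Poisson(\<open>t p\<close>) the probability \<open>P(S \<le> c)\<close> has derivative
  \<open>(1 - t) p\<^sup>2 (P(V = c) - P(V = c - 1))\<close>, where \<open>V\<close> is the sum of the other summands and the
  Poisson(\<open>t p\<close>) part. Since \<open>c + 1 \<le> E S\<close>, the mean of \<open>V\<close> is at least \<open>c\<close>, and weights are
  nondecreasing up to the mean, so the derivative is nonnegative.

  For the second inequality, \<open>e\<^sup>x\<^sup>/\<^sup>k P(Poisson(x) < k)\<close> is nonincreasing for \<open>x \<ge> k\<close>, and
  \<open>P(Poisson(k) < k) \<le> 1/2\<close> because \<open>P(Poisson(k e\<^sup>s) < k) + P(Poisson(k e\<^sup>-\<^sup>s) < k)\<close> increases to 1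
  as \<open>s\<close> tends to infinity.
\<close>

section \<open>Weights of a Bernoulli sum with an independent Poisson part\<close>

unbundle no vec_syntax
unbundle fps_syntax

text \<open>Probability generating function of independent Bernoulli(\<open>p\<^sub>i\<close>), \<open>i \<in> I\<close>, plus an independent
  Poisson(\<open>\<theta>\<close>).\<close>

definition pb_fps :: "('i \<Rightarrow> real) \<Rightarrow> 'i set \<Rightarrow> real \<Rightarrow> real fps" where
  "pb_fps p I \<theta> =
     (\<Prod>i\<in>I. fps_const (1 - p i) + fps_const (p i) * fps_X) * (fps_const (exp (- \<theta>)) * fps_exp \<theta>)"

lemma pb_fps_insert:
  assumes "finite I" "i \<notin> I"
  shows "pb_fps p (insert i I) \<theta> = (fps_const (1 - p i) + fps_const (p i) * fps_X) * pb_fps p I \<theta>"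
  using assms by (simp add: pb_fps_def mult.assoc)

lemma pb_fps_nth_empty: "pb_fps p {} \<theta> $ c = exp (- \<theta>) * \<theta> ^ c / fact c"
  by (simp add: pb_fps_def)

text \<open>The new factor is \<open>1 - p i * (1 - fps_X)\<close>, and multiplication by
  \<open>1 - fps_X\<close> takes backward differences of the weights, the weight at -1 being read as
  0.\<close>

lemma pb_fps_nth_insert:
  assumes "finite I" "i \<notin> I"
  shows "pb_fps p (insert i I) \<theta> $ c =
    pb_fps p I \<theta> $ c - p i * ((1 - fps_X) * pb_fps p I \<theta>) $ c"
  by (simp add: pb_fps_insert[OF assms] algebra_simps)

lemma pb_fps_nth_nonneg:
  assumes "finite I" "\<And>i. i \<in> I \<Longrightarrow> p i \<in> {0..1}" "0 \<le> \<theta>"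
  shows "0 \<le> pb_fps p I \<theta> $ c"
  using assms
proof (induction I arbitrary: c rule: finite_induct)
  case empty
  then show ?case by (simp add: pb_fps_nth_empty)
next
  case (insert i I)
  have "pb_fps p (insert i I) \<theta> $ c =
    (1 - p i) * pb_fps p I \<theta> $ c + p i * (if c = 0 then 0 else pb_fps p I \<theta> $ (c - 1))"
    using insert by (simp add: pb_fps_insert distrib_right mult.assoc)
  then show ?case using insert by simp
qed

text \<open>Product rule: each linear factor has constant derivative \<open>p i\<close>, and the
  exponential factor reproduces itself times \<open>\<theta>\<close>.\<close>

lemma fps_deriv_pb_fps:
  assumes "finite I"
  shows "fps_deriv (pb_fps p I \<theta>) =
    (\<Sum>i\<in>I. fps_const (p i) * pb_fps p (I - {i}) \<theta>) + fps_const \<theta> * pb_fps p I \<theta>"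
  using assms
proof (induction I rule: finite_induct)
  case empty
  then show ?case by (simp add: pb_fps_def algebra_simps)
next
  case (insert i I)
  let ?L = "fps_const (1 - p i) + fps_const (p i) * fps_X"
  have eq: "pb_fps p (insert i I - {j}) \<theta> = ?L * pb_fps p (I - {j}) \<theta>" if "j \<in> I" for j
  proof -
    have "insert i I - {j} = insert i (I - {j})" using that insert by auto
    then show ?thesis using insert by (simp add: pb_fps_insert)
  qed
  have "(\<Sum>j\<in>I. fps_const (p j) * pb_fps p (insert i I - {j}) \<theta>) =
        ?L * (\<Sum>j\<in>I. fps_const (p j) * pb_fps p (I - {j}) \<theta>)"
    unfolding sum_distrib_left by (intro sum.cong refl) (simp only: eq mult.left_commute)
  moreover have "fps_deriv ?L = fps_const (p i)" by simp
  moreover have "insert i I - {i} = I" using insert by auto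
  ultimately show ?case
    using insert by (simp add: pb_fps_insert distrib_left mult.left_commute del: fps_deriv_add)
qed

text \<open>Writing \<open>a\<^sub>c\<close> for the weights, the logarithmic derivative of the generating function expresses
  \<open>c (a\<^sub>c - a\<^sub>c\<^sub>-\<^sub>1)\<close> as \<open>(\<mu> - c) a\<^sub>c\<^sub>-\<^sub>1\<close> plus a combination, with weights \<open>p\<^sub>i\<^sup>2\<close>, of the same
  differences at \<open>c - 1\<close> with the \<open>i\<close>-th summand removed; its mean drops by at most 1.\<close>

lemma pb_fps_nth_mono_below_mean:
  assumes "finite I" "\<And>i. i \<in> I \<Longrightarrow> p i \<in> {0..1}" "0 \<le> \<theta>" "real c \<le> \<theta> + (\<Sum>i\<in>I. p i)"
  shows "0 \<le> ((1 - fps_X) * pb_fps p I \<theta>) $ c"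
  using assms
proof (induction c arbitrary: I)
  case 0
  then show ?case by (simp add: left_diff_distrib pb_fps_nth_nonneg)
next
  case (Suc c)
  let ?a = "\<lambda>I c. pb_fps p I \<theta> $ c"
  define d where "d i = ((1 - fps_X) * pb_fps p (I - {i}) \<theta>) $ c" for i
  have rem: "?a I c = ?a (I - {i}) c - p i * d i" if "i \<in> I" for i
    using pb_fps_nth_insert[of "I - {i}" i p \<theta> c] that Suc.prems(1)
    by (simp add: insert_absorb d_def)
  have "real (Suc c) * ?a I (Suc c) = fps_deriv (pb_fps p I \<theta>) $ c"
    by simp
  also have "\<dots> = (\<Sum>i\<in>I. p i * ?a (I - {i}) c) + \<theta> * ?a I c"
    by (simp only: fps_deriv_pb_fps[OF Suc.prems(1)]) (simp add: fps_sum_nth)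
  also have "(\<Sum>i\<in>I. p i * ?a (I - {i}) c) = (\<Sum>i\<in>I. p i * ?a I c + (p i)\<^sup>2 * d i)"
  proof (intro sum.cong refl)
    fix i assume "i \<in> I"
    then have "?a (I - {i}) c = ?a I c + p i * d i" using rem by simp
    then show "p i * ?a (I - {i}) c = p i * ?a I c + (p i)\<^sup>2 * d i"
      by (simp only: distrib_left power2_eq_square mult.assoc)
  qed
  finally have "real (Suc c) * (?a I (Suc c) - ?a I c) =
      (\<theta> + (\<Sum>i\<in>I. p i) - real (Suc c)) * ?a I c + (\<Sum>i\<in>I. (p i)\<^sup>2 * d i)"
    by (simp add: sum.distrib algebra_simps sum_distrib_left sum_distrib_right)
  also have "\<dots> \<ge> 0"
  proof (intro add_nonneg_nonneg mult_nonneg_nonneg sum_nonneg)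
    show "0 \<le> ?a I c" using Suc.prems by (intro pb_fps_nth_nonneg) auto
    fix i assume i: "i \<in> I"
    have "(\<Sum>i\<in>I. p i) = p i + (\<Sum>i\<in>I - {i}. p i)" using Suc.prems(1) i by (rule sum.remove)
    moreover have "p i \<le> 1" using Suc.prems(2)[OF i] by simp
    ultimately have "real c \<le> \<theta> + (\<Sum>i\<in>I - {i}. p i)" using Suc.prems(4) by simp
    then show "0 \<le> d i" unfolding d_def using Suc.prems by (intro Suc.IH) auto
  qed (use Suc.prems in auto)
  finally have "?a I c \<le> ?a I (Suc c)"
    by (simp add: zero_le_mult_iff del: of_nat_Suc)
  then show ?case by (simp add: left_diff_distrib)
qed

text \<open>Only the Poisson factor depends on \<open>\<theta>\<close>; it is the exponential of
  \<open>\<theta>\<close> times (z - 1), so differentiation multiplies the generating function by z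
  - 1.\<close>

lemma pb_fps_nth_has_derivative:
  assumes "finite I"
  shows "((\<lambda>\<theta>. pb_fps p I \<theta> $ c) has_real_derivative - (((1 - fps_X) * pb_fps p I \<theta>) $ c)) (at \<theta>)"
  using assms
proof (induction I arbitrary: c rule: finite_induct)
  case empty
  show ?case
  proof (cases c)
    case 0
    then show ?thesis
      by (auto simp: pb_fps_nth_empty left_diff_distrib intro!: derivative_eq_intros)
  next
    case (Suc m)
    have "((\<lambda>\<theta>. exp (- \<theta>) * \<theta> ^ Suc m / fact (Suc m)) has_real_derivative
        (exp (- \<theta>) * (real (Suc m) * \<theta> ^ m) - exp (- \<theta>) * \<theta> ^ Suc m) / fact (Suc m)) (at \<theta>)"
      by (intro DERIV_cdivide) (auto intro!: derivative_eq_intros simp del: power_Suc)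
    moreover have "exp (- \<theta>) * (real (Suc m) * \<theta> ^ m) / fact (Suc m) = exp (- \<theta>) * \<theta> ^ m / fact m"
      by (simp add: fact_Suc del: of_nat_Suc)
    ultimately show ?thesis
      using Suc by (simp add: pb_fps_nth_empty left_diff_distrib diff_divide_distrib)
  qed
next
  case (insert i I)
  let ?L = "fps_const (1 - p i) + fps_const (p i) * fps_X"
  have nth: "(?L * F) $ c = (1 - p i) * F $ c + p i * (if c = 0 then 0 else F $ (c - 1))" for F c
    by (simp add: distrib_right mult.assoc)
  have "(1 - fps_X) * pb_fps p (insert i I) \<theta> = ?L * ((1 - fps_X) * pb_fps p I \<theta>)"
    by (simp only: pb_fps_insert[OF insert.hyps] mult.left_commute)
  then have eq: "((1 - fps_X) * pb_fps p (insert i I) \<theta>) $ c =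
     (1 - p i) * ((1 - fps_X) * pb_fps p I \<theta>) $ c +
     p i * (if c = 0 then 0 else ((1 - fps_X) * pb_fps p I \<theta>) $ (c - 1))"
    by (simp only: nth)
  show ?case
    unfolding eq unfolding pb_fps_insert[OF insert(1,2)] nth
    by (cases c) (auto intro!: derivative_eq_intros insert.IH simp del: fps_mult_nth_0)
qed

section \<open>Distribution functions and the replacement of Bernoulli by Poisson\<close>

definition pb_cdf :: "('i \<Rightarrow> real) \<Rightarrow> 'i set \<Rightarrow> real \<Rightarrow> nat \<Rightarrow> real" where
  "pb_cdf p I \<theta> c = (\<Sum>j\<le>c. pb_fps p I \<theta> $ j)"

lemma sum_nth_one_minus_fps_X:
  fixes F :: "real fps"
  shows "(\<Sum>j\<le>c. ((1 - fps_X) * F) $ j) = F $ c"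
  by (induction c) (simp_all add: left_diff_distrib)

lemma pb_cdf_insert:
  assumes "finite I" "i \<notin> I"
  shows "pb_cdf p (insert i I) \<theta> c = pb_cdf p I \<theta> c - p i * pb_fps p I \<theta> $ c"
  unfolding pb_cdf_def pb_fps_nth_insert[OF assms] sum_subtractf
  by (simp only: sum_distrib_left[symmetric] sum_nth_one_minus_fps_X)

lemma pb_cdf_has_derivative:
  assumes "finite I"
  shows "((\<lambda>\<theta>. pb_cdf p I \<theta> c) has_real_derivative - (pb_fps p I \<theta> $ c)) (at \<theta>)"
proof -
  have "((\<lambda>\<theta>. pb_cdf p I \<theta> c) has_real_derivative
      (\<Sum>j\<le>c. - (((1 - fps_X) * pb_fps p I \<theta>) $ j))) (at \<theta>)"
    unfolding pb_cdf_def by (intro DERIV_sum pb_fps_nth_has_derivative assms)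
  then show ?thesis by (simp only: sum_negf sum_nth_one_minus_fps_X)
qed

lemma pb_cdf_insert_le_poisson:
  assumes I: "finite I" "i \<notin> I" and p: "\<And>j. j \<in> insert i I \<Longrightarrow> p j \<in> {0..1}"
    and "0 \<le> \<theta>" and mean: "real c + 1 \<le> \<theta> + (\<Sum>j\<in>insert i I. p j)"
  shows "pb_cdf p (insert i I) \<theta> c \<le> pb_cdf p I (\<theta> + p i) c"
proof -
  \<comment> \<open>Distribution function at \<open>c\<close> when summand \<open>i\<close> has
    parameter \<open>(1 - t) * p i\<close> and the Poisson mean is
    \<open>\<theta> + t * p i\<close>; \<open>t = 0\<close> and \<open>t = 1\<close> give the two
    sides of the claim.\<close>
  define h where "h t = pb_cdf p I (\<theta> + t * p i) c - (1 - t) * p i * pb_fps p I (\<theta> + t * p i) $ c" for t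
  define d where "d t = ((1 - fps_X) * pb_fps p I (\<theta> + t * p i)) $ c" for t
  have pi: "0 \<le> p i" "p i \<le> 1" using p[of i] by auto
  have "h 0 \<le> h 1"
  proof (rule DERIV_nonneg_imp_nondecreasing[where f = h])
    fix t :: real assume t: "0 \<le> t" "t \<le> 1"
    have lin: "((\<lambda>t. \<theta> + t * p i) has_real_derivative p i) (at t)"
      by (auto intro!: derivative_eq_intros)
    note D = DERIV_chain2[OF pb_cdf_has_derivative[OF I(1)] lin]
      DERIV_chain2[OF pb_fps_nth_has_derivative[OF I(1)] lin]
    \<comment> \<open>The terms linear in \<open>p i\<close> cancel: one comes from the moving
      Poisson mean, the other from the factor \<open>1 - t\<close>.\<close>
    have "(h has_real_derivative (1 - t) * (p i)\<^sup>2 * d t) (at t)"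
      unfolding h_def [abs_def]
      by (rule derivative_eq_intros D refl)+ (simp add: d_def algebra_simps power2_eq_square)
    moreover have "0 \<le> d t"
      unfolding d_def
    proof (rule pb_fps_nth_mono_below_mean[OF I(1)])
      \<comment> \<open>The spare 1 in the mean hypothesis pays for omitting summand
        \<open>i\<close>.\<close>
      have "real c + 1 \<le> \<theta> + (p i + (\<Sum>j\<in>I. p j))" using mean I by simp
      moreover have "0 \<le> t * p i" using t pi by simp
      ultimately show "real c \<le> \<theta> + t * p i + (\<Sum>j\<in>I. p j)" using pi by simp
    qed (use p t pi \<open>0 \<le> \<theta>\<close> in auto)
    ultimately show "\<exists>y. (h has_real_derivative y) (at t) \<and> 0 \<le> y"
      using t by auto
  qed simp
  then show ?thesis by (simp add: h_def pb_cdf_insert[OF I])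
qed

text \<open>\<open>\<theta>\<close> must vary in the induction: it absorbs the mean of each replaced
  summand, so the total mean stays fixed.\<close>

lemma pb_cdf_le_poisson_cdf:
  assumes "finite I" "\<And>i. i \<in> I \<Longrightarrow> p i \<in> {0..1}" "0 \<le> \<theta>" "real c + 1 \<le> \<theta> + (\<Sum>i\<in>I. p i)"
  shows "pb_cdf p I \<theta> c \<le> pb_cdf p {} (\<theta> + (\<Sum>i\<in>I. p i)) c"
  using assms
proof (induction I arbitrary: \<theta> rule: finite_induct)
  case empty
  then show ?case by simp
next
  case (insert i I)
  have "pb_cdf p (insert i I) \<theta> c \<le> pb_cdf p I (\<theta> + p i) c"
    using insert by (intro pb_cdf_insert_le_poisson) auto
  also have "\<dots> \<le> pb_cdf p {} (\<theta> + p i + (\<Sum>i\<in>I. p i)) c"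
    using insert by (intro insert.IH) (auto simp: algebra_simps)
  finally show ?case using insert by (simp add: algebra_simps)
qed

section \<open>The Poisson distribution function as a function of its mean\<close>

definition poisson_cdf :: "nat \<Rightarrow> real \<Rightarrow> real" where
  "poisson_cdf m x = exp (- x) * (\<Sum>i = 0..m. x ^ i / fact i)"

lemma pb_cdf_empty: "pb_cdf p {} \<theta> c = poisson_cdf c \<theta>"
  by (simp add: pb_cdf_def poisson_cdf_def pb_fps_nth_empty sum_distrib_left atMost_atLeast0)

text \<open>For \<open>x \<ge> 0\<close> this is minus the Gamma density of shape
  \<open>m + 1\<close>, so \<open>poisson_cdf m\<close> is the survival function of that
  law.\<close>

lemma poisson_cdf_has_derivative:
  "(poisson_cdf m has_real_derivative - (exp (- x) * x ^ m / fact m)) (at x)"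
  using pb_cdf_has_derivative[of "{}" p m x for p]
  by (simp add: pb_cdf_empty pb_fps_nth_empty)

lemma poisson_cdf_tendsto_0: "(poisson_cdf m \<longlongrightarrow> 0) at_top"
proof -
  have "((\<lambda>x::real. \<Sum>i = 0..m. x ^ i / exp x / fact i) \<longlongrightarrow> (\<Sum>i = 0..m. 0 / fact i)) at_top"
    by (intro tendsto_sum tendsto_divide[OF tendsto_power_div_exp_0 tendsto_const] fact_nonzero)
  moreover have "(\<lambda>x. \<Sum>i = 0..m. x ^ i / exp x / fact i) = poisson_cdf m"
    by (auto simp: poisson_cdf_def sum_distrib_left exp_minus field_simps intro!: ext sum.cong)
  ultimately show ?thesis by simp
qed

text \<open>That is, sinh s is at least s; rearranged, it compares the exponents of the Gamma
  density at the two arguments \<open>k * exp s\<close> and \<open>k * exp (- s)\<close>.\<close>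

lemma two_mult_le_exp_diff:
  fixes s :: real
  assumes "0 \<le> s"
  shows "2 * s \<le> exp s - exp (- s)"
proof -
  have "(\<lambda>s. exp s - exp (- s) - 2 * s) 0 \<le> (\<lambda>s::real. exp s - exp (- s) - 2 * s) s"
  proof (rule DERIV_nonneg_imp_nondecreasing[OF assms])
    fix x :: real
    have "((\<lambda>s. exp s - exp (- s) - 2 * s) has_real_derivative exp x + exp (- x) - 2) (at x)"
      by (auto intro!: derivative_eq_intros)
    moreover have "0 \<le> exp x + exp (- x) - 2"
      using exp_ge_add_one_self[of x] exp_ge_add_one_self[of "-x"] by linarith
    ultimately show "\<exists>y. ((\<lambda>s. exp s - exp (- s) - 2 * s) has_real_derivative y) (at x) \<and> 0 \<le> y"
      by blast
  qed
  then show ?thesis by simp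
qed

text \<open>On the logarithmic scale \<open>x = k e\<^sup>s\<close> the density of the Gamma(\<open>k\<close>) distribution at \<open>-s\<close> dominates
  the one at \<open>s > 0\<close>, so that \<open>k\<close> is at least its median.\<close>

lemma poisson_cdf_at_Suc_le_half: "poisson_cdf m (real (Suc m)) \<le> 1 / 2"
proof -
  define k where "k = real (Suc m)"
  have k: "k > 0" by (simp add: k_def)
  define H where "H s = poisson_cdf m (k * exp s) + poisson_cdf m (k * exp (- s))" for s
  have mono: "H 0 \<le> H s" if "0 \<le> s" for s
  proof (rule DERIV_nonneg_imp_nondecreasing[OF that])
    fix s :: real assume s: "0 \<le> s"
    \<comment> \<open>The Gamma density times \<open>x\<close>, the extra factor being the Jacobian
      of the logarithmic scale.\<close>
    define g where "g x = exp (- x) * x ^ Suc m / fact m" for x :: real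
    have lin: "((\<lambda>s. k * exp s) has_real_derivative k * exp s) (at s)"
      "((\<lambda>s. k * exp (- s)) has_real_derivative - (k * exp (- s))) (at s)"
      by (auto intro!: derivative_eq_intros)
    have "(H has_real_derivative g (k * exp (- s)) - g (k * exp s)) (at s)"
      unfolding H_def [abs_def]
      by (rule derivative_eq_intros DERIV_chain2[OF poisson_cdf_has_derivative lin(1)]
          DERIV_chain2[OF poisson_cdf_has_derivative lin(2)] refl)+ (simp add: g_def mult_ac)
    moreover have "g (k * exp s) \<le> g (k * exp (- s))"
    proof -
      have g: "g (k * exp r) = k ^ Suc m * exp (k * (r - exp r)) / fact m" for r
      proof -
        \<comment> \<open>Here \<open>k = Suc m\<close> matters: it lets the power
          \<open>Suc m\<close> merge into the exponent.\<close>
        have "exp (k * (r - exp r)) = exp (- (k * exp r)) * exp r ^ Suc m"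
          unfolding exp_of_nat_mult[symmetric] exp_add[symmetric] k_def by (simp add: algebra_simps)
        then show ?thesis by (simp only: g_def power_mult_distrib mult_ac)
      qed
      have "k * (s - exp s) \<le> k * (- s - exp (- s))"
        using two_mult_le_exp_diff[OF s] k by (intro mult_left_mono) auto
      then show ?thesis
        unfolding g using k by (intro divide_right_mono mult_left_mono) auto
    qed
    ultimately show "\<exists>y. (H has_real_derivative y) (at s) \<and> 0 \<le> y"
      by (meson diff_ge_0_iff_ge)
  qed
  have "filterlim (\<lambda>s. k * exp s) at_top at_top"
    using k by (intro filterlim_tendsto_pos_mult_at_top[OF tendsto_const] exp_at_top)
  then have "((\<lambda>s. poisson_cdf m (k * exp s)) \<longlongrightarrow> 0) at_top"
    by (rule filterlim_compose[OF poisson_cdf_tendsto_0])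
  moreover have "((\<lambda>s. k * exp (- s)) \<longlongrightarrow> k * 0) at_top"
    by (intro tendsto_mult tendsto_const filterlim_compose[OF exp_at_bot filterlim_uminus_at_bot_at_top])
  then have "((\<lambda>s. poisson_cdf m (k * exp (- s))) \<longlongrightarrow> poisson_cdf m (k * 0)) at_top"
    by (rule isCont_tendsto_compose[OF DERIV_isCont[OF poisson_cdf_has_derivative]])
  ultimately have "(H \<longlongrightarrow> 0 + poisson_cdf m (k * 0)) at_top"
    unfolding H_def [abs_def] by (rule tendsto_add)
  moreover have "poisson_cdf m 0 = 1"
    by (simp add: poisson_cdf_def power_0_left if_distrib[of "\<lambda>x. x / _"] cong: if_cong)
  ultimately have "(H \<longlongrightarrow> 1) at_top" by simp
  then have "H 0 \<le> 1"
    by (rule tendsto_lowerbound) (auto intro!: mono eventually_mono[OF eventually_ge_at_top[of 0]])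
  then show ?thesis by (simp add: H_def k_def)
qed

text \<open>For \<open>x \<ge> m\<close> the largest of the \<open>m + 1\<close> terms of the sum is the last one, so the hazard rate
  of the Gamma distribution is at least \<open>1 / (m + 1)\<close>.\<close>

lemma poisson_cdf_le_last_term:
  assumes "real m \<le> x"
  shows "poisson_cdf m x \<le> real (Suc m) * (exp (- x) * x ^ m / fact m)"
proof -
  have "x ^ i / fact i \<le> x ^ m / fact m" if "i \<le> m" for i
    using that assms
  proof (induction m rule: dec_induct)
    case base
    then show ?case by simp
  next
    case (step n)
    have "x ^ i / fact i \<le> x ^ n / fact n * 1" using step by simp
    \<comment> \<open>The ratio of consecutive terms is at least 1 because
      \<open>Suc n \<le> x\<close>.\<close>
    also have "\<dots> \<le> x ^ n / fact n * (x / real (Suc n))"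
      using step.prems by (intro mult_left_mono) auto
    also have "\<dots> = x ^ Suc n / fact (Suc n)" by (simp add: field_simps)
    finally show ?case .
  qed
  then have "(\<Sum>i = 0..m. x ^ i / fact i) \<le> (\<Sum>i = 0..m. x ^ m / fact m)"
    by (intro sum_mono) auto
  then have "(\<Sum>i = 0..m. x ^ i / fact i) \<le> real (Suc m) * (x ^ m / fact m)" by simp
  then have "poisson_cdf m x \<le> exp (- x) * (real (Suc m) * (x ^ m / fact m))"
    unfolding poisson_cdf_def by (intro mult_left_mono) auto
  then show ?thesis by (simp add: mult_ac)
qed

lemma poisson_cdf_le_exp:
  assumes "real (Suc m) \<le> x"
  shows "poisson_cdf m x \<le> exp (- (x / real (Suc m))) * (exp 1 / 2)"
proof -
  define k where "k = real (Suc m)"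
  have k: "k > 0" by (simp add: k_def)
  define f where "f x = exp (x / k) * poisson_cdf m x" for x
  have "f x \<le> f k"
  proof (rule DERIV_nonpos_imp_nonincreasing[where f = f])
    show "k \<le> x" using assms by (simp add: k_def)
    fix t assume t: "k \<le> t"
    have "(f has_real_derivative
        exp (t / k) * (poisson_cdf m t / k - exp (- t) * t ^ m / fact m)) (at t)"
      unfolding f_def [abs_def] using k
      by (auto intro!: derivative_eq_intros poisson_cdf_has_derivative simp: algebra_simps)
    moreover have "poisson_cdf m t / k \<le> exp (- t) * t ^ m / fact m"
      using poisson_cdf_le_last_term[of m t] t k by (simp add: k_def divide_le_eq mult_ac)
    ultimately show "\<exists>y. (f has_real_derivative y) (at t) \<and> y \<le> 0"
      by (meson diff_le_0_iff_le exp_ge_zero mult_nonneg_nonpos)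
  qed
  \<comment> \<open>Source of the constant: \<open>exp (k / k)\<close> gives e, the median bound
    gives 1/2.\<close>
  also have "f k \<le> exp 1 * (1 / 2)"
    unfolding f_def using poisson_cdf_at_Suc_le_half[of m] k
    by (simp add: k_def)
  finally have "exp (- (x / k)) * f x \<le> exp (- (x / k)) * (exp 1 / 2)"
    by (intro mult_left_mono) auto
  then show ?thesis by (simp add: f_def k_def flip: mult.assoc exp_add)
qed

section \<open>From random variables to generating functions\<close>

context prob_space
begin

lemma bernoulli_distributed_measurable:
  "bernoulli_distributed X q \<Longrightarrow> X \<in> borel_measurable M"
  by (simp add: bernoulli_distributed_def)

lemma bernoulli_distributed_prob:
  assumes "bernoulli_distributed X q" "q \<in> {0..1}" "A \<in> sets borel"
  shows "prob (X -` A \<inter> space M) = q * indicator A 1 + (1 - q) * indicator A 0"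
proof -
  have "prob (X -` A \<inter> space M) = measure (distr M borel X) A"
    using assms by (simp add: measure_distr bernoulli_distributed_measurable)
  also have "\<dots> = measure (distr (measure_pmf (bernoulli_pmf q)) borel of_bool) A"
    using assms by (simp add: bernoulli_distributed_def)
  also have "\<dots> = measure (measure_pmf (bernoulli_pmf q)) (of_bool -` A)"
    using assms by (simp add: measure_distr)
  also have "\<dots> = measure_pmf.expectation (bernoulli_pmf q) (indicator (of_bool -` A))"
    by simp
  also have "\<dots> = q * indicator A 1 + (1 - q) * indicator A 0"
    using assms by (subst integral_bernoulli_pmf) (auto simp: indicator_def)
  finally show ?thesis .
qed

text \<open>Only the law of \<open>X\<close> is prescribed, so other values can occur on a null
  set.\<close>

lemma bernoulli_distributed_AE:
  assumes "bernoulli_distributed X q" "q \<in> {0..1}"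
  shows "AE \<omega> in M. X \<omega> = 0 \<or> X \<omega> = 1"
proof -
  have "prob (X -` {0, 1} \<inter> space M) = 1"
    using bernoulli_distributed_prob[OF assms, of "{0, 1}"] by simp
  moreover have "X -` {0, 1} \<inter> space M \<in> events"
    using bernoulli_distributed_measurable[OF assms(1)] by (rule measurable_sets) simp
  ultimately have "AE \<omega> in M. \<omega> \<in> X -` {0, 1} \<inter> space M"
    by (simp add: prob_eq_1)
  then show ?thesis by eventually_elim auto
qed

lemma bernoulli_distributed_integrable:
  assumes "bernoulli_distributed X q" "q \<in> {0..1}"
  shows "integrable M X"
proof (rule integrable_const_bound[where B = 1])
  show "AE \<omega> in M. norm (X \<omega>) \<le> 1"
    using bernoulli_distributed_AE[OF assms] by eventually_elim auto
qed (rule bernoulli_distributed_measurable[OF assms(1)])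

lemma bernoulli_distributed_expectation:
  assumes "bernoulli_distributed X q" "q \<in> {0..1}"
  shows "expectation X = q"
proof -
  have "expectation X = (\<integral>x. x \<partial>distr M borel X)"
    using assms by (simp add: integral_distr bernoulli_distributed_measurable)
  also have "\<dots> = (\<integral>x. x \<partial>distr (measure_pmf (bernoulli_pmf q)) borel of_bool)"
    using assms by (simp add: bernoulli_distributed_def)
  also have "\<dots> = measure_pmf.expectation (bernoulli_pmf q) of_bool"
    by (simp add: integral_distr)
  also have "\<dots> = q"
    using assms by (subst integral_bernoulli_pmf) auto
  finally show ?thesis .
qed

text \<open>Splits on the value of \<open>X\<close>; the events agree up to a null set, and
  independence factors each piece.\<close>

lemma prob_add_bernoulli_le:
  assumes X: "bernoulli_distributed X q" "q \<in> {0..1}" and ind: "indep_var borel X borel Y"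
  shows "prob {\<omega> \<in> space M. X \<omega> + Y \<omega> \<le> c} =
    (1 - q) * prob {\<omega> \<in> space M. Y \<omega> \<le> c} + q * prob {\<omega> \<in> space M. Y \<omega> \<le> c - 1}"
proof -
  note [measurable] = indep_var_rv1[OF ind] indep_var_rv2[OF ind]
  have prod: "prob {\<omega> \<in> space M. X \<omega> = x \<and> Y \<omega> \<le> d} =
      prob (X -` {x} \<inter> space M) * prob {\<omega> \<in> space M. Y \<omega> \<le> d}" for x d
    using indep_varD[OF ind, of "{x}" "{..d}"]
    by (simp add: vimage_def Int_def conj_commute conj_left_commute)
  have "prob {\<omega> \<in> space M. X \<omega> + Y \<omega> \<le> c} =
      prob ({\<omega> \<in> space M. X \<omega> = 0 \<and> Y \<omega> \<le> c} \<union> {\<omega> \<in> space M. X \<omega> = 1 \<and> Y \<omega> \<le> c - 1})"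
    using bernoulli_distributed_AE[OF X] by (intro measure_eq_AE) auto
  also have "\<dots> = prob {\<omega> \<in> space M. X \<omega> = 0 \<and> Y \<omega> \<le> c} + prob {\<omega> \<in> space M. X \<omega> = 1 \<and> Y \<omega> \<le> c - 1}"
    by (intro finite_measure_Union) auto
  finally show ?thesis
    using X by (simp add: prod bernoulli_distributed_prob)
qed

text \<open>Identifies the formal weights with the actual law; splitting off one summand gives the
  recurrence of \<open>pb_cdf_insert\<close>.\<close>

lemma prob_sum_bernoulli_le:
  assumes "finite I" "\<And>i. i \<in> I \<Longrightarrow> p i \<in> {0..1}"
    and "\<And>i. i \<in> I \<Longrightarrow> bernoulli_distributed (X i) (p i)" "indep_vars (\<lambda>_. borel) X I"
  shows "prob {\<omega> \<in> space M. (\<Sum>i\<in>I. X i \<omega>) \<le> real c} = pb_cdf p I 0 c"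
  using assms
proof (induction I arbitrary: c rule: finite_induct)
  case empty
  have "(\<Sum>j\<le>c. 0 ^ j / fact j :: real) = 1" by (induction c) auto
  then show ?case by (simp add: prob_space pb_cdf_def pb_fps_nth_empty)
next
  case (insert i I)
  let ?Y = "\<lambda>\<omega>. \<Sum>i\<in>I. X i \<omega>"
  have IH: "prob {\<omega> \<in> space M. ?Y \<omega> \<le> real c} = pb_cdf p I 0 c" for c
    using insert.prems by (intro insert.IH indep_vars_subset[OF insert.prems(3)]) auto
  have "indep_var borel (X i) borel ?Y"
    using insert by (intro indep_vars_sum) auto
  then have step: "prob {\<omega> \<in> space M. X i \<omega> + ?Y \<omega> \<le> real c} =
      (1 - p i) * pb_cdf p I 0 c + p i * prob {\<omega> \<in> space M. ?Y \<omega> \<le> real c - 1}"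
    using insert.prems by (subst prob_add_bernoulli_le[where q = "p i"]) (auto simp: IH)
  have pred: "prob {\<omega> \<in> space M. ?Y \<omega> \<le> real c - 1} = pb_cdf p I 0 c - pb_fps p I 0 $ c"
  proof (cases c)
    \<comment> \<open>The threshold is -1, outside the induction hypothesis; the sum is almost
      surely nonnegative, so both sides vanish.\<close>
    case 0
    have "AE \<omega> in M. \<forall>i\<in>I. X i \<omega> = 0 \<or> X i \<omega> = 1"
      using insert by (intro AE_finite_allI bernoulli_distributed_AE) auto
    then have "AE \<omega> in M. 0 \<le> ?Y \<omega>"
      by eventually_elim (auto intro!: sum_nonneg)
    then have "prob {\<omega> \<in> space M. ?Y \<omega> \<le> - 1} = prob {}"
      using insert.prems(2) bernoulli_distributed_measurable
      by (intro measure_eq_AE) auto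
    then show ?thesis using 0 by (simp add: pb_cdf_def)
  next
    case (Suc m)
    then show ?thesis using IH[of m] by (simp add: pb_cdf_def)
  qed
  show ?case
    unfolding sum.insert[OF insert.hyps] step pred pb_cdf_insert[OF insert.hyps]
    by (simp add: algebra_simps)
qed

end

theorem theorem10:
  fixes M :: "'a measure"
    and X :: "nat \<Rightarrow> 'a \<Rightarrow> real"
    and p :: "nat \<Rightarrow> real"
    and n k :: nat
    and S :: "'a \<Rightarrow> real"
    and lam \<gamma> :: real
  assumes "prob_space M"
    and "\<And>i. i \<in> {1..n} \<Longrightarrow> p i \<in> {0..1}"
    and "\<And>i. i \<in> {1..n} \<Longrightarrow> prob_space.bernoulli_distributed M (X i) (p i)"
    and "prob_space.indep_vars M (\<lambda>_. borel) X {1..n}"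
    and "S = (\<lambda>\<omega>. \<Sum>i = 1..n. X i \<omega>)"
    and "k > 0"
    and "real k \<le> prob_space.expectation M S"
    and "lam = prob_space.expectation M S"
    and "\<gamma> = prob_space.expectation M S / real k"
  shows "prob_space.prob M {\<omega> \<in> space M. S \<omega> \<le> real k - 1}
           \<le> exp (- lam) * (\<Sum>i = 0..k - 1. lam ^ i / fact i)
       \<and> exp (- lam) * (\<Sum>i = 0..k - 1. lam ^ i / fact i) \<le> exp (- \<gamma>) * (exp 1 / 2)"
proof -
  interpret prob_space M by fact
  obtain m where k: "k = Suc m" using \<open>k > 0\<close> by (cases k) auto
  have "lam = (\<Sum>i = 1..n. expectation (X i))"
    unfolding \<open>lam = _\<close> \<open>S = _\<close>
    using assms(2,3) by (intro Bochner_Integration.integral_sum bernoulli_distributed_integrable)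
  also have "\<dots> = (\<Sum>i = 1..n. p i)"
    using assms(2,3) by (intro sum.cong refl bernoulli_distributed_expectation)
  finally have lam: "lam = (\<Sum>i = 1..n. p i)" .
  have le: "real (Suc m) \<le> lam" using assms k by simp
  have "prob {\<omega> \<in> space M. S \<omega> \<le> real m} = pb_cdf p {1..n} 0 m"
    unfolding \<open>S = _\<close> using assms(2-4) by (intro prob_sum_bernoulli_le) auto
  also have "\<dots> \<le> pb_cdf p {} (0 + (\<Sum>i = 1..n. p i)) m"
    \<comment> \<open>With \<open>c = m\<close>, the condition \<open>c + 1\<close> at most the mean
      is exactly \<open>k \<le> lam\<close>.\<close>
    using assms(2) le lam by (intro pb_cdf_le_poisson_cdf) auto
  also have "\<dots> = poisson_cdf m lam" by (simp add: pb_cdf_empty lam)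
  finally have "prob {\<omega> \<in> space M. S \<omega> \<le> real m} \<le> poisson_cdf m lam" .
  moreover have "poisson_cdf m lam \<le> exp (- \<gamma>) * (exp 1 / 2)"
    using poisson_cdf_le_exp[OF le] assms(8,9) k by simp
  ultimately show ?thesis by (simp add: k poisson_cdf_def)
qed

end
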